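(* Let $n\ge 4$ be even and let $G$ be the 2-regular graph on $n$ vertices consisting of $n/2$ vertex-disjoint double edges. Then the number of compatible cycles for $G$ is exactly $$\frac12\,(n-2)!!\;\mathcal{S}_H^{\pm}\!\left(\tfrac n2-1,\,1\right),$$ where $\mathcal{S}_H^{\pm}(m,k)$ denotes the signed Hultman number.
   Context: Graphs are finite, loopless, and may have multiple edges; vertices are labelled. For two graphs $G_1,G_2$ on the same vertex set, $G_1\cup G_2$ denotes the graph on that vertex set whose edge multiset is the disjoint union of the edges of $G_1$ and of $G_2$ (multiplicities add). A cycle on a vertex set $V$ is a connected 2-regular graph with vertex set $V$. Given a 2-regular graph $G$ on a vertex set $V$, a compatible cycle for $G$ is a cycle $C$ on $V$ such that $G\cup C=C_1\cup C_2$ (as edge multisets) for some cycles $C_1$ and $C_2$ on $V$. Compatible cycles are counted as labelled graphs on $V$. $m!!$ denotes the double factorial $m(m-2)(m-4)\cdots$, with $0!!=1$. Signed Hultman numbers: a signed permutation on $m$ elements is a sequence $\pi=(\pi_1,\dots,\pi_m)$ of nonzero integers such that $(|\pi_1|,\dots,|\pi_m|)$ is a permutation of $\{1,\dots,m\}$. Define a permutation $\pi'=(\pi'_0,\pi'_1,\dots,\pi'_{2m+1})$ of $\{0,1,\dots,2m+1\}$ by $\pi'_0=0$, $\pi'_{2m+1}=2m+1$, and for $1\le i\le m$: $(\pi'_{2i-1},\pi'_{2i})=(2\pi_i-1,\,2\pi_i)$ if $\pi_i>0$, and $(\pi'_{2i-1},\pi'_{2i})=(2|\pi_i|,\,2|\pi_i|-1)$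 if $\pi_i<0$. The breakpoint graph of $\pi$ is the graph $\delta_B\cup\delta_G$ on the vertex set $\{0,1,\dots,2m+1\}$, where $\delta_B=\{\{\pi'_{2i},\pi'_{2i+1}\}:0\le i\le m\}$ and $\delta_G=\{\{2i,2i+1\}:0\le i\le m\}$; it is 2-regular, hence a disjoint union of cycles (a double edge counts as a cycle of length 2). The signed Hultman number $\mathcal{S}_H^{\pm}(m,k)$ is the number of signed permutations on $m$ elements whose breakpoint graph consists of exactly $k$ disjoint cycles. *)

theory Defs
  imports Complex_Main "HOL-Library.Multiset" "HOL-Library.Disjoint_Sets"
begin

(* A graph is given by its vertex set V and the multiset E of its edges, an edge being the
   two-element set of its end points.  Parallel edges are therefore not distinguished from each
   other, and graphs on V are counted as labelled graphs by counting the multisets E.  The union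
   of two graphs on V is the multiset sum E1 + E2. *)

definition multigraph :: "'a set \<Rightarrow> 'a set multiset \<Rightarrow> bool" where
  "multigraph V E \<longleftrightarrow> finite V \<and> (\<forall>e \<in># E. e \<subseteq> V \<and> card e = 2)"

definition degree :: "'a set multiset \<Rightarrow> 'a \<Rightarrow> nat" where
  "degree E v = size {# e \<in># E. v \<in> e #}"

definition two_regular :: "'a set \<Rightarrow> 'a set multiset \<Rightarrow> bool" where
  "two_regular V E \<longleftrightarrow> multigraph V E \<and> (\<forall>v \<in> V. degree E v = 2)"

definition connected_graph :: "'a set \<Rightarrow> 'a set multiset \<Rightarrow> bool" where
  "connected_graph V E \<longleftrightarrow>
     V \<noteq> {} \<and> (\<forall>u \<in> V. \<forall>v \<in> V. (u, v) \<in> {(x, y). {x, y} \<in># E}\<^sup>*)"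

definition cycle_on :: "'a set \<Rightarrow> 'a set multiset \<Rightarrow> bool" where
  "cycle_on V C \<longleftrightarrow> two_regular V C \<and> connected_graph V C"

definition compatible_cycle :: "'a set \<Rightarrow> 'a set multiset \<Rightarrow> 'a set multiset \<Rightarrow> bool" where
  "compatible_cycle V G C \<longleftrightarrow>
     cycle_on V C \<and> (\<exists>C1 C2. cycle_on V C1 \<and> cycle_on V C2 \<and> G + C = C1 + C2)"

definition disjoint_double_edges :: "'a set \<Rightarrow> 'a set multiset \<Rightarrow> bool" where
  "disjoint_double_edges V G \<longleftrightarrow>
     finite V \<and>
     (\<exists>M. partition_on V M \<and> (\<forall>e \<in> M. card e = 2) \<and> G = mset_set M + mset_set M)"

definition disjoint_cycles :: "'a set \<Rightarrow> 'a set multiset \<Rightarrow> nat \<Rightarrow> bool" where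
  "disjoint_cycles V E k \<longleftrightarrow>
     (\<exists>P F. finite P \<and> card P = k \<and> partition_on V P \<and>
            (\<forall>W \<in> P. cycle_on W (F W)) \<and> E = (\<Sum>W \<in> P. F W))"

fun double_factorial :: "nat \<Rightarrow> nat" where
  "double_factorial 0 = 1"
| "double_factorial (Suc 0) = 1"
| "double_factorial (Suc (Suc m)) = Suc (Suc m) * double_factorial m"

definition signed_perms :: "nat \<Rightarrow> int list set" where
  "signed_perms m =
     {\<pi>. length \<pi> = m \<and> distinct (map abs \<pi>) \<and> set (map abs \<pi>) = {1..int m}}"

(* The sequence pi' = (pi'_0, ..., pi'_(2m+1)) as a list, indexed from 0. *)
definition extended_perm :: "int list \<Rightarrow> int list" where
  "extended_perm \<pi> =
     [0]
     @ concat (map (\<lambda>x. if x > 0 then [2 * x - 1, 2 * x] else [2 * \<bar>x\<bar>, 2 * \<bar>x\<bar> - 1]) \<pi>)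
     @ [2 * int (length \<pi>) + 1]"

definition black_edges :: "int list \<Rightarrow> int set multiset" where
  "black_edges \<pi> =
     {# {extended_perm \<pi> ! (2 * i), extended_perm \<pi> ! (2 * i + 1)}.
        i \<in># mset_set {0..length \<pi>} #}"

definition grey_edges :: "nat \<Rightarrow> int set multiset" where
  "grey_edges m = {# {2 * int i, 2 * int i + 1}. i \<in># mset_set {0..m} #}"

definition breakpoint_graph :: "int list \<Rightarrow> int set multiset" where
  "breakpoint_graph \<pi> = black_edges \<pi> + grey_edges (length \<pi>)"

definition signed_hultman :: "nat \<Rightarrow> nat \<Rightarrow> nat" where
  "signed_hultman m k =
     card {\<pi> \<in> signed_perms m. disjoint_cycles {0..2 * int m + 1} (breakpoint_graph \<pi>) k}"

end

theory Submission
  imports Defs "HOL-Combinatorics.Multiset_Permutations"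
begin

text \<open>
  Let \<open>G = M + M\<close> with \<open>M\<close> a perfect matching. Since a cycle on at least three vertices has no
  repeated edge, \<open>G + C = C1 + C2\<close> forces \<open>C1 = M + A\<close>, \<open>C2 = M + B\<close> and \<open>C = A + B\<close> for perfect
  matchings \<open>A\<close> and \<open>B\<close>, and \<open>{A, B}\<close> is determined by the cycle \<open>C\<close>. So the compatible cycles are
  half as many as the pairs \<open>(A, B)\<close> for which each two of \<open>M\<close>, \<open>A\<close>, \<open>B\<close> form a Hamiltonian cycle.

  Reading off the vertices of an alternating Hamiltonian cycle \<open>M + A\<close> in order identifies \<open>M\<close> with
  the matching \<open>{2i - 1, 2i}\<close>, \<open>{2m + 1, 0}\<close> of \<open>{0..2m + 1}\<close> and \<open>A\<close> with the grey edges \<open>{2i, 2i + 1}\<close>.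
  With \<open>M\<close> fixed in this way, the matchings that complete it to a Hamiltonian cycle are exactly the
  sets of black edges of signed permutations of \<open>m\<close> elements. Hence there are
  \<open>2^m m! = (2m)!!\<close> choices of \<open>A\<close>, and for each of them the matchings \<open>B\<close> correspond to the signed
  permutations whose breakpoint graph is a single cycle.
\<close>

section \<open>Perfect matchings\<close>

definition perfect_matching :: "'a set \<Rightarrow> 'a set set \<Rightarrow> bool" where
  "perfect_matching V M \<longleftrightarrow> partition_on V M \<and> (\<forall>e \<in> M. card e = 2)"

text \<open>A matching is handled through this map, a fixed-point-free involution of
  \<open>V\<close>, so that edges can be followed like steps. Its value carries meaning only at
  vertices of \<open>V\<close>.\<close>

definition partner :: "'a set set \<Rightarrow> 'a \<Rightarrow> 'a" where
  "partner M v = (THE u. {v, u} \<in> M)"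

lemma perfect_matching_ex1_partner:
  assumes "perfect_matching V M" "v \<in> V"
  shows "\<exists>!u. {v, u} \<in> M"
proof -
  have part: "partition_on V M" and card2: "\<And>e. e \<in> M \<Longrightarrow> card e = 2"
    using assms by (auto simp: perfect_matching_def)
  obtain e where e: "e \<in> M" "v \<in> e"
    using part assms(2) by (auto simp: partition_on_def)
  then obtain u where u: "e = {v, u}"
    using card2[OF e(1)] by (auto simp: card_2_iff)
  show ?thesis
  proof
    show "{v, u} \<in> M" using e u by simp
  next
    fix w assume w: "{v, w} \<in> M"
    have "{v, w} = {v, u}"
    proof (rule ccontr)
      assume "{v, w} \<noteq> {v, u}"
      moreover have "{v, u} \<in> M" using e u by simp
      ultimately have "{v, w} \<inter> {v, u} = {}"
        by (rule disjointD[OF partition_onD2[OF part] w, rotated])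
      then show False by simp
    qed
    then show "w = u" by (auto simp: doubleton_eq_iff)
  qed
qed

lemma partner_edge:
  assumes "perfect_matching V M" "v \<in> V"
  shows "{v, partner M v} \<in> M"
  unfolding partner_def by (rule theI'[OF perfect_matching_ex1_partner[OF assms]])

lemma perfect_matching_edge_subset:
  assumes "perfect_matching V M" "e \<in> M"
  shows "e \<subseteq> V"
  using assms by (auto simp: perfect_matching_def partition_on_def)

lemma partner_eqI:
  assumes "perfect_matching V M" "{v, u} \<in> M"
  shows "partner M v = u"
proof -
  have "v \<in> V" using perfect_matching_edge_subset[OF assms] by auto
  from perfect_matching_ex1_partner[OF assms(1) this] assms(2) show ?thesis
    unfolding partner_def by (intro the1_equality)
qed

lemma partner_in:
  assumes "perfect_matching V M" "v \<in> V"
  shows "partner M v \<in> V"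
  using perfect_matching_edge_subset[OF assms(1) partner_edge[OF assms]] by auto

lemma partner_partner:
  assumes "perfect_matching V M" "v \<in> V"
  shows "partner M (partner M v) = v"
  using partner_edge[OF assms] by (intro partner_eqI[OF assms(1)]) (simp add: insert_commute)

lemma partner_neq:
  assumes "perfect_matching V M" "v \<in> V"
  shows "partner M v \<noteq> v"
proof
  assume "partner M v = v"
  with partner_edge[OF assms] have "{v} \<in> M" by simp
  then have "card {v} = 2" using assms(1) unfolding perfect_matching_def by blast
  then show False by simp
qed

lemma perfect_matching_eq_image:
  assumes "perfect_matching V M"
  shows "M = (\<lambda>v. {v, partner M v}) ` V"
proof (intro equalityI subsetI)
  fix e assume e: "e \<in> M"
  then have "card e = 2" using assms by (auto simp: perfect_matching_def)
  then obtain u v where uv: "e = {u, v}" by (auto simp: card_2_iff)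
  then have "u \<in> V" using perfect_matching_edge_subset[OF assms e] by simp
  moreover have "v = partner M u" using partner_eqI[OF assms] e uv by simp
  ultimately show "e \<in> (\<lambda>v. {v, partner M v}) ` V" using uv by auto
qed (auto intro: partner_edge[OF assms])

lemma edge_eq_partner:
  assumes "perfect_matching V M" "e \<in> M" "v \<in> e"
  shows "e = {v, partner M v}"
proof -
  have "card e = 2" using assms by (auto simp: perfect_matching_def)
  then obtain u where "e = {v, u}" using assms(3) by (auto simp: card_2_iff)
  then show ?thesis using partner_eqI[OF assms(1), of v u] assms(2) by simp
qed

lemma perfect_matching_eqI:
  assumes "perfect_matching V M" "perfect_matching V M'"
    and "\<And>v. v \<in> V \<Longrightarrow> partner M v = partner M' v"
  shows "M = M'"
  using perfect_matching_eq_image[OF assms(1)] perfect_matching_eq_image[OF assms(2)] assms(3)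
  by (metis (no_types, lifting) image_cong)

text \<open>Each vertex already has its only edge of \<open>M'\<close> inside \<open>M\<close>.
  Matchings are identified below by checking one inclusion.\<close>

lemma perfect_matching_eq_of_subset:
  assumes "M \<subseteq> M'" "perfect_matching V M" "perfect_matching V M'"
  shows "M = M'"
proof (rule perfect_matching_eqI[OF assms(2,3)])
  fix v assume "v \<in> V"
  then have "{v, partner M v} \<in> M'" using partner_edge[OF assms(2)] assms(1) by blast
  then show "partner M v = partner M' v" using partner_eqI[OF assms(3)] by simp
qed

lemma finite_perfect_matching:
  assumes "perfect_matching V M" "finite V"
  shows "finite M"
  using perfect_matching_eq_image[OF assms(1)] assms(2) by (metis finite_imageI)

lemma perfect_matchingI:
  assumes "\<And>e. e \<in> M \<Longrightarrow> card e = 2" "\<Union>M = V"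
    and "\<And>e e'. e \<in> M \<Longrightarrow> e' \<in> M \<Longrightarrow> e \<inter> e' \<noteq> {} \<Longrightarrow> e = e'"
  shows "perfect_matching V M"
  unfolding perfect_matching_def
proof (intro conjI ballI partition_onI)
  show "{} \<notin> M" using assms(1) by force
  show "disjnt e e'" if "e \<in> M" "e' \<in> M" "e \<noteq> e'" for e e'
    using assms(3)[OF that(1,2)] that(3) by (auto simp: disjnt_def)
qed (use assms in auto)

lemma card_perfect_matching:
  assumes "perfect_matching V M" "finite V"
  shows "card V = 2 * card M"
proof -
  have "card V = sum card M"
    using assms perfect_matching_edge_subset[OF assms(1)]
    by (intro product_partition) (auto simp: perfect_matching_def intro: finite_subset)
  also have "\<dots> = (\<Sum>e\<in>M. 2)"
    using assms by (intro sum.cong) (auto simp: perfect_matching_def)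
  finally show ?thesis by simp
qed

section \<open>Transport of matchings along bijections\<close>

lemma perfect_matching_image:
  assumes "perfect_matching V M" "bij_betw f V W"
  shows "perfect_matching W ((`) f ` M)"
proof (rule perfect_matchingI)
  have inj: "inj_on f V" and im: "f ` V = W" using assms(2) by (auto simp: bij_betw_def)
  note sub = perfect_matching_edge_subset[OF assms(1)]
  show "card e = 2" if "e \<in> (`) f ` M" for e
    using that assms(1) sub inj
    by (auto simp: perfect_matching_def card_image inj_on_subset)
  show "\<Union> ((`) f ` M) = W"
    using assms(1) im by (auto simp: perfect_matching_def partition_on_def)
  fix e e' assume "e \<in> (`) f ` M" "e' \<in> (`) f ` M" and ne: "e \<inter> e' \<noteq> {}"
  then obtain d d' where d: "d \<in> M" "d' \<in> M" "e = f ` d" "e' = f ` d'" by auto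
  have "d \<inter> d' \<noteq> {}"
    using ne d sub[OF d(1)] sub[OF d(2)] inj_on_image_Int[OF inj, of d d'] by auto
  then have "d = d'"
    using assms(1) d by (auto simp: perfect_matching_def partition_on_def disjoint_def)
  then show "e = e'" using d by simp
qed

lemma partner_image:
  assumes "perfect_matching V M" "bij_betw f V W" "v \<in> V"
  shows "partner ((`) f ` M) (f v) = f (partner M v)"
proof (rule partner_eqI[OF perfect_matching_image[OF assms(1,2)]])
  have "f ` {v, partner M v} \<in> (`) f ` M" using partner_edge[OF assms(1,3)] by blast
  then show "{f v, f (partner M v)} \<in> (`) f ` M" by simp
qed

text \<open>Pair off the edges of \<open>M\<close> and \<open>N\<close>, choose a bijection between
  the ends for each pair of edges, and glue these bijections.\<close>

lemma perfect_matchings_isomorphic: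
  assumes "perfect_matching V M" "perfect_matching W N" "finite V" "finite W" "card V = card W"
  shows "\<exists>f. bij_betw f V W \<and> (`) f ` M = N"
proof -
  have "finite M" "finite N" "card M = card N"
    using assms card_perfect_matching[of V M] card_perfect_matching[of W N]
    by (auto intro: finite_perfect_matching)
  then obtain p where p: "bij_betw p M N" using finite_same_card_bij by blast
  have "\<exists>h. bij_betw h e (p e)" if "e \<in> M" for e
  proof (rule finite_same_card_bij)
    have "p e \<in> N" using p that by (auto simp: bij_betw_def)
    then show "card e = card (p e)" "finite e" "finite (p e)"
      using that assms(1,2) by (auto simp: perfect_matching_def intro: card_ge_0_finite)
  qed
  then obtain h where h: "\<And>e. e \<in> M \<Longrightarrow> bij_betw (h e) e (p e)" by metis
  \<comment> \<open>Every vertex uses the bijection chosen for its own edge.\<close>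
  define f where "f v = h {v, partner M v} v" for v
  have fe: "f ` e = p e" if "e \<in> M" for e
  proof -
    have "f ` e = h e ` e" using edge_eq_partner[OF assms(1) that] by (intro image_cong) (auto simp: f_def)
    then show ?thesis using h[OF that] by (simp add: bij_betw_def)
  qed
  have MN: "(`) f ` M = N" using fe p by (auto simp: bij_betw_def)
  moreover have "f ` V = W"
  proof -
    have "f ` \<Union>M = \<Union>N" using MN by blast
    then show ?thesis using assms(1,2) by (simp add: perfect_matching_def partition_on_def)
  qed
  \<comment> \<open>A surjection between finite sets of equal size is injective.\<close>
  ultimately show ?thesis
    using assms(3,5) eq_card_imp_inj_on[of V f] by (auto simp: bij_betw_def)
qed

section \<open>Alternating Hamiltonian cycles\<close>

text \<open>The union of two perfect matchings is 2-regular, so being a Hamiltonian cycle amounts to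
  connectedness. This is stated as the absence of a proper nonempty subset closed under both partner
  maps, which serves directly as an induction principle. A double edge on two vertices is
  included.\<close>

definition alternating_cycle :: "'a set \<Rightarrow> 'a set set \<Rightarrow> 'a set set \<Rightarrow> bool" where
  "alternating_cycle V M A \<longleftrightarrow> perfect_matching V M \<and> perfect_matching V A \<and> V \<noteq> {} \<and>
     (\<forall>S. S \<subseteq> V \<longrightarrow> S \<noteq> {} \<longrightarrow> partner M ` S \<subseteq> S \<longrightarrow> partner A ` S \<subseteq> S \<longrightarrow> S = V)"

lemma alternating_cycle_commute: "alternating_cycle V M A \<longleftrightarrow> alternating_cycle V A M"
  unfolding alternating_cycle_def by blast

lemma alternating_cycle_closed_eq:
  assumes "alternating_cycle V M A" "S \<subseteq> V" "S \<noteq> {}"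
    and "\<And>v. v \<in> S \<Longrightarrow> partner M v \<in> S" "\<And>v. v \<in> S \<Longrightarrow> partner A v \<in> S"
  shows "S = V"
  using assms unfolding alternating_cycle_def by (metis image_subsetI)

lemma alternating_cycle_image:
  assumes "alternating_cycle V M A" "bij_betw f V W"
  shows "alternating_cycle W ((`) f ` M) ((`) f ` A)"
proof -
  have pm: "perfect_matching V M" "perfect_matching V A" "V \<noteq> {}"
    using assms(1) by (auto simp: alternating_cycle_def)
  have im: "f ` V = W" using assms(2) by (auto simp: bij_betw_def)
  show ?thesis unfolding alternating_cycle_def
  proof (intro conjI allI impI)
    show "W \<noteq> {}" using pm im by auto
    fix S assume S: "S \<subseteq> W" "S \<noteq> {}"
      "partner ((`) f ` M) ` S \<subseteq> S" "partner ((`) f ` A) ` S \<subseteq> S"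
    \<comment> \<open>The preimage of a closed set is closed, because \<open>f\<close> commutes with
      the partner maps.\<close>
    define T where "T = {v \<in> V. f v \<in> S}"
    have "T = V"
    proof (rule alternating_cycle_closed_eq[OF assms(1)])
      show "T \<subseteq> V" "T \<noteq> {}" using S im by (auto simp: T_def)
      fix v assume "v \<in> T"
      then show "partner M v \<in> T" "partner A v \<in> T"
        using S(3,4) partner_image[OF pm(1) assms(2), of v] partner_image[OF pm(2) assms(2), of v]
          partner_in[OF pm(1)] partner_in[OF pm(2)]
        by (auto simp: T_def image_subset_iff)
    qed
    then show "S = W" using S im by (auto simp: T_def)
  qed (use perfect_matching_image pm assms(2) in auto)
qed

section \<open>Alternating cycles given by enumerations of the vertices\<close>

definition even_matching :: "(nat \<Rightarrow> 'a) \<Rightarrow> nat \<Rightarrow> 'a set set" where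
  "even_matching a m = (\<lambda>i. {a (2 * i), a (2 * i + 1)}) ` {..m}"

text \<open>Along the closed walk \<open>a 0\<close>, ..., \<open>a (2 * m + 1)\<close> these are
  the edges that \<open>even_matching\<close> skips; the inserted edge closes the walk.\<close>

definition odd_matching :: "(nat \<Rightarrow> 'a) \<Rightarrow> nat \<Rightarrow> 'a set set" where
  "odd_matching a m =
     insert {a (2 * m + 1), a 0} ((\<lambda>i. {a (2 * i + 1), a (2 * i + 2)}) ` {..<m})"

lemma even_matching_image: "(`) f ` even_matching a m = even_matching (f \<circ> a) m"
  by (simp add: even_matching_def image_image)

lemma odd_matching_image: "(`) f ` odd_matching a m = odd_matching (f \<circ> a) m"
  by (simp add: odd_matching_def image_image)

lemma even_matching_cong:
  assumes "\<And>i. i < 2 * m + 2 \<Longrightarrow> a i = b i"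
  shows "even_matching a m = even_matching b m"
  unfolding even_matching_def by (intro image_cong) (auto simp: assms)

lemma odd_matching_cong:
  assumes "\<And>i. i < 2 * m + 2 \<Longrightarrow> a i = b i"
  shows "odd_matching a m = odd_matching b m"
  unfolding odd_matching_def by (intro arg_cong2[of _ _ _ _ insert] image_cong) (auto simp: assms)

text \<open>Only the identity enumeration needs index arithmetic; all others are its images under a
  bijection.\<close>

lemma perfect_matching_even_id: "perfect_matching {..<2 * m + 2} (even_matching (\<lambda>i. i) m)"
proof (rule perfect_matchingI)
  show "\<Union> (even_matching (\<lambda>i. i) m) = {..<2 * m + 2}"
  proof (intro equalityI subsetI)
    fix i assume "i \<in> {..<2 * m + 2}"
    then have "i div 2 \<le> m" "i = 2 * (i div 2) \<or> i = 2 * (i div 2) + 1" by auto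
    then show "i \<in> \<Union> (even_matching (\<lambda>i. i) m)"
      unfolding even_matching_def by blast
  qed (auto simp: even_matching_def)
  show "e = e'" if "e \<in> even_matching (\<lambda>i. i) m" "e' \<in> even_matching (\<lambda>i. i) m" "e \<inter> e' \<noteq> {}" for e e'
  proof -
    obtain i j where ij: "e = {2*i, 2*i+1}" "e' = {2*j, 2*j+1}"
      using \<open>e \<in> _\<close> \<open>e' \<in> _\<close> by (auto simp: even_matching_def)
    have "i = j" using \<open>e \<inter> e' \<noteq> {}\<close> unfolding ij by (auto; presburger)
    then show ?thesis using ij by simp
  qed
qed (auto simp: even_matching_def)

lemma perfect_matching_odd_id: "perfect_matching {..<2 * m + 2} (odd_matching (\<lambda>i. i) m)"
proof (rule perfect_matchingI)
  show "\<Union> (odd_matching (\<lambda>i. i) m) = {..<2 * m + 2}"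
  proof (intro equalityI subsetI)
    fix i :: nat assume i: "i \<in> {..<2 * m + 2}"
    show "i \<in> \<Union> (odd_matching (\<lambda>i. i) m)"
    proof (cases "i = 0 \<or> i = 2 * m + 1")
      case False
      then have "(i - 1) div 2 < m" "i = 2 * ((i - 1) div 2) + 1 \<or> i = 2 * ((i - 1) div 2) + 2"
        using i by auto
      then show ?thesis unfolding odd_matching_def by blast
    qed (auto simp: odd_matching_def)
  qed (auto simp: odd_matching_def)
  show "e = e'" if e: "e \<in> odd_matching (\<lambda>i. i) m" "e' \<in> odd_matching (\<lambda>i. i) m" "e \<inter> e' \<noteq> {}"
    for e e'
  proof -
    have inner: "i = j" if "{2*i+1, 2*i+2} \<inter> {2*j+1, 2*j+2} \<noteq> {}" for i j :: nat
    proof -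
      have "2*i+1 = 2*j+1 \<or> 2*i+1 = 2*j+2 \<or> 2*i+2 = 2*j+1 \<or> 2*i+2 = 2*j+2"
        using that by blast
      then show ?thesis by presburger
    qed
    have last: "{2*m+1, 0} \<inter> {2*i+1, 2*i+2} = {}" if "i < m" for i
      using that by auto
    consider "e = {2*m+1, 0}" | i where "i < m" "e = {2*i+1, 2*i+2}"
      using e(1) by (auto simp: odd_matching_def)
    then show ?thesis
    proof cases
      case 1
      have "e' \<noteq> {2*i+1, 2*i+2}" if "i < m" for i
        using last[OF that] 1 e(3) by blast
      then show ?thesis using 1 e(2) by (auto simp: odd_matching_def)
    next
      case (2 i)
      consider "e' = {2*m+1, 0}" | j where "j < m" "e' = {2*j+1, 2*j+2}"
        using e(2) by (auto simp: odd_matching_def)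
      then show ?thesis
      proof cases
        case 1
        then show ?thesis using last[OF 2(1)] 2(2) e(3) by blast
      next
        case (2 j)
        then show ?thesis using inner[of i j] \<open>e = {2*i+1, 2*i+2}\<close> e(3) by simp
      qed
    qed
  qed
qed (auto simp: odd_matching_def)

lemma perfect_matching_even:
  assumes "bij_betw a {..<2 * m + 2} V"
  shows "perfect_matching V (even_matching a m)"
  using perfect_matching_image[OF perfect_matching_even_id assms]
  by (simp add: even_matching_image comp_def)

lemma perfect_matching_odd:
  assumes "bij_betw a {..<2 * m + 2} V"
  shows "perfect_matching V (odd_matching a m)"
  using perfect_matching_image[OF perfect_matching_odd_id assms]
  by (simp add: odd_matching_image comp_def)

lemma partner_even_matching:
  assumes "bij_betw a {..<2 * m + 2} V" "i \<le> m"
  shows "partner (even_matching a m) (a (2 * i)) = a (2 * i + 1)"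
  using assms by (intro partner_eqI[OF perfect_matching_even]) (auto simp: even_matching_def)

lemma partner_odd_matching:
  assumes "bij_betw a {..<2 * m + 2} V"
  shows "i < m \<Longrightarrow> partner (odd_matching a m) (a (2 * i + 1)) = a (2 * i + 2)"
    and "partner (odd_matching a m) (a (2 * m + 1)) = a 0"
  by (rule partner_eqI[OF perfect_matching_odd[OF assms]], simp add: odd_matching_def)+

text \<open>Consecutive vertices are partners in one of the two matchings, so a closed set contains
  all of them or none.\<close>

lemma alternating_cycle_enumeration:
  assumes "bij_betw a {..<2 * m + 2} V"
  shows "alternating_cycle V (odd_matching a m) (even_matching a m)"
proof -
  let ?O = "odd_matching a m" and ?E = "even_matching a m"
  note pm = perfect_matching_odd[OF assms] perfect_matching_even[OF assms]
  have V: "V = a ` {..<2 * m + 2}" using assms by (simp add: bij_betw_def)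
  show ?thesis unfolding alternating_cycle_def
  proof (intro conjI allI impI pm)
    show "V \<noteq> {}" using V by auto
    fix S assume S: "S \<subseteq> V" "S \<noteq> {}" "partner ?O ` S \<subseteq> S" "partner ?E ` S \<subseteq> S"
    have step: "a i \<in> S \<longleftrightarrow> a (Suc i) \<in> S" if "i < 2 * m + 1" for i
    proof -
      have "a i \<in> V" "a (Suc i) \<in> V" using that V by auto
      have "partner ?E (a i) = a (Suc i) \<or> partner ?O (a i) = a (Suc i)"
      proof (cases "even i")
        case True
        then show ?thesis using partner_even_matching[OF assms, of "i div 2"] that by auto
      next
        case False
        then show ?thesis using partner_odd_matching(1)[OF assms, of "i div 2"] that
          by (auto elim!: oddE)
      qed
      moreover from this have "partner ?E (a (Suc i)) = a i \<or> partner ?O (a (Suc i)) = a i"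
        using partner_partner pm \<open>a i \<in> V\<close> by metis
      ultimately show ?thesis using S(3,4) by (metis image_subset_iff)
    qed
    have "a i \<in> S \<longleftrightarrow> a 0 \<in> S" if "i < 2 * m + 2" for i
      using that by (induction i) (auto simp: step[symmetric])
    then show "S = V" using S(1,2) V by blast
  qed
qed

text \<open>The walk from \<open>z\<close> using the edges of \<open>A\<close> and \<open>M\<close> in turn can only close up at \<open>z\<close>: the
  vertices visited so far are matched among themselves by \<open>A\<close>, and those other than the two ends
  also by \<open>M\<close>. Once it closes up, it has visited a closed set, hence everything.\<close>

lemma alternating_cycle_obtain_enumeration:
  assumes "alternating_cycle V M A" "card V = 2 * m + 2" "z \<in> V"
  obtains a where "bij_betw a {..<2 * m + 2} V" "a 0 = z"
    "M = odd_matching a m" "A = even_matching a m"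
proof -
  have pm: "perfect_matching V M" "perfect_matching V A"
    using assms(1) by (auto simp: alternating_cycle_def)
  have fin: "finite V" using assms(2) by (intro card_ge_0_finite) simp
  \<comment> \<open>Step \<open>i\<close> follows \<open>A\<close> for even \<open>i\<close>, so
    \<open>A\<close> will become the even matching. The sequence is infinite; distinctness is shown
    for its first \<open>2 * m + 2\<close> entries.\<close>
  define a where "a = rec_nat z (\<lambda>i x. if even i then partner A x else partner M x)"
  have a0: "a 0 = z" by (simp add: a_def)
  have aA: "a (2 * i + 1) = partner A (a (2 * i))" for i by (simp add: a_def)
  have aM: "a (2 * i + 2) = partner M (a (2 * i + 1))" for i by (simp add: a_def)
  have aV: "a i \<in> V" for i
    by (induction i) (auto simp: a_def assms(3) intro: partner_in pm)
  have A_closed: "partner A (a i) \<in> a ` {..<2 * k + 2}" if "i < 2 * k + 2" for i k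
  proof (cases "even i")
    case True
    then obtain j where j: "i = 2 * j" by (elim evenE)
    then have "partner A (a i) = a (2 * j + 1)" using aA[of j] by simp
    moreover have "2 * j + 1 < 2 * k + 2" using j that by presburger
    ultimately show ?thesis by blast
  next
    case False
    then obtain j where j: "i = 2 * j + 1" by (elim oddE)
    then have "partner A (a i) = a (2 * j)" using aA[of j] partner_partner[OF pm(2) aV] by simp
    then show ?thesis using j that by auto
  qed
  have M_inner: "partner M (a i) \<in> a ` {0<..<2 * k + 1}" if "0 < i" "i < 2 * k + 1" for i k
  proof (cases "even i")
    case True
    then obtain j where "i = 2 * j" by (elim evenE)
    with that have j: "i = 2 * (j - 1) + 2" by simp
    then have "partner M (a i) = a (2 * (j - 1) + 1)"
      using aM[of "j - 1"] partner_partner[OF pm(1) aV] by metis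
    moreover have "2 * (j - 1) + 1 \<in> {0<..<2 * k + 1}" using that j by simp
    ultimately show ?thesis by blast
  next
    case False
    then obtain j where j: "i = 2 * j + 1" by (auto elim: oddE)
    then have "partner M (a i) = a (2 * j + 2)" using aM[of j] by simp
    moreover have "2 * j + 2 \<in> {0<..<2 * k + 1}" using that j by simp
    ultimately show ?thesis by blast
  qed
  have M_last: "partner M (a (2 * k + 1)) = a 0"
    if last: "partner M (a (2 * k + 1)) \<in> a ` {..<2 * k + 2}" and inj: "inj_on a {..<2 * k + 2}" for k
  proof -
    obtain i where i: "i < 2 * k + 2" "partner M (a (2 * k + 1)) = a i" using last by auto
    have "partner M (a i) = a (2 * k + 1)" using i(2) partner_partner[OF pm(1) aV] by metis
    moreover have "a (2 * k + 1) \<notin> a ` {0<..<2 * k + 1}"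
      using inj by (auto dest: inj_onD)
    ultimately have "\<not> (0 < i \<and> i < 2 * k + 1)" using M_inner[of i k] by metis
    moreover have "i \<noteq> 2 * k + 1" using partner_neq[OF pm(1) aV] i(2) by metis
    ultimately have "i = 0" using i(1) by linarith
    then show ?thesis using i by simp
  qed
  have inj: "inj_on a {..<2 * k + 2}" if "k \<le> m" for k
    using that
  proof (induction k)
    case 0
    have "a 1 \<noteq> a 0" using aA[of 0] partner_neq[OF pm(2) aV, of 0] by simp
    then show ?case by (simp add: lessThan_Suc numeral_2_eq_2)
  next
    \<comment> \<open>Two vertices are added at a time. If the first were old, the visited vertices
      would form a closed set of size \<open>2 * k + 2\<close>, smaller than \<open>V\<close>; the
      second is new because its \<open>A\<close>-partner is.\<close>
    case (Suc k)
    let ?S = "a ` {..<2 * k + 2}"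
    have inj: "inj_on a {..<2 * k + 2}" using Suc by simp
    have new: "a (2 * k + 2) \<notin> ?S"
    proof
      assume "a (2 * k + 2) \<in> ?S"
      then have last: "partner M (a (2 * k + 1)) = a 0" using M_last[OF _ inj] aM[of k] by simp
      then have first: "partner M (a 0) = a (2 * k + 1)" using partner_partner[OF pm(1) aV] by metis
      have "partner M (a i) \<in> ?S" if i: "i < 2 * k + 2" for i
      proof -
        consider "i = 0" | "i = 2 * k + 1" | "0 < i" "i < 2 * k + 1" using i by linarith
        then show ?thesis using M_inner[of i k] last first by cases auto
      qed
      then have "?S = V"
        using A_closed[of _ k] aV by (intro alternating_cycle_closed_eq[OF assms(1)]) auto
      then have "card V = 2 * k + 2" using card_image[OF inj] by simp
      then show False using assms(2) Suc.prems by simp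
    qed
    have "a (2 * k + 3) = partner A (a (2 * k + 2))" using aA[of "k + 1"] by (simp add: eval_nat_numeral)
    then have eq: "partner A (a (2 * k + 3)) = a (2 * k + 2)" "a (2 * k + 3) \<noteq> a (2 * k + 2)"
      using partner_partner[OF pm(2) aV] partner_neq[OF pm(2) aV] by metis+
    have "a (2 * k + 3) \<notin> ?S"
    proof
      assume "a (2 * k + 3) \<in> ?S"
      then have "partner A (a (2 * k + 3)) \<in> ?S" using A_closed[of _ k] by auto
      then show False using eq new by simp
    qed
    moreover have "{..<2 * Suc k + 2} = insert (2 * k + 3) (insert (2 * k + 2) {..<2 * k + 2})"
      by auto
    ultimately show ?case using inj new eq(2) by simp
  qed
  have im: "a ` {..<2 * m + 2} = V"
    using card_image[OF inj[of m]] assms(2) aV fin by (intro card_subset_eq) auto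
  have bij: "bij_betw a {..<2 * m + 2} V" using inj[of m] im by (simp add: bij_betw_def)
  have lastm: "partner M (a (2 * m + 1)) = a 0"
    using M_last[OF _ inj[of m]] im partner_in[OF pm(1) aV] by simp
  have "even_matching a m \<subseteq> A"
    using partner_edge[OF pm(2) aV] by (auto simp: even_matching_def aA[simplified])
  moreover have "odd_matching a m \<subseteq> M"
    using partner_edge[OF pm(1) aV, of "2 * m + 1"] partner_edge[OF pm(1) aV] aM
    by (auto simp: odd_matching_def lastm[simplified])
  ultimately have "A = even_matching a m" "M = odd_matching a m"
    using perfect_matching_eq_of_subset[OF _ perfect_matching_even[OF bij] pm(2)]
      perfect_matching_eq_of_subset[OF _ perfect_matching_odd[OF bij] pm(1)] by auto
  then show ?thesis using that bij a0 by blast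
qed

text \<open>The starting vertex and the two partner maps determine the walk step by step. This gives
  the injectivity of the encoding by signed permutations.\<close>

lemma alternating_cycle_enumerations_eq:
  assumes a: "bij_betw a {..<2 * m + 2} V" and b: "bij_betw b {..<2 * m + 2} V" and "a 0 = b 0"
    and "odd_matching a m = odd_matching b m" "even_matching a m = even_matching b m"
    and "i < 2 * m + 2"
  shows "a i = b i"
  using assms(6)
proof (induction i)
  case (Suc i)
  then have IH: "a i = b i" by simp
  show ?case
  proof (cases "even i")
    case True
    then obtain j where j: "i = 2 * j" by (elim evenE)
    with Suc.prems have "j \<le> m" by simp
    then show ?thesis
      using partner_even_matching[OF a, of j] partner_even_matching[OF b, of j] IH assms(5) j by simp
  next
    case False
    then obtain j where j: "i = 2 * j + 1" by (elim oddE)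
    with Suc.prems have "j < m" by simp
    then show ?thesis
      using partner_odd_matching(1)[OF a, of j] partner_odd_matching(1)[OF b, of j] IH assms(4) j
      by simp
  qed
qed (rule assms(3))

section \<open>Counts of alternating cycles are invariant under bijections\<close>

lemma finite_alternating_cycles:
  assumes "finite V"
  shows "finite {B. alternating_cycle V M B}"
proof (rule finite_subset)
  show "{B. alternating_cycle V M B} \<subseteq> Pow (Pow V)"
    by (auto simp: alternating_cycle_def dest: perfect_matching_edge_subset)
qed (use assms in simp)

text \<open>Transport along \<open>f\<close> is injective on sets of edges inside \<open>V\<close>.
  Applying the inequality to the inverse of \<open>f\<close> as well yields equality in the next
  lemma.\<close>

lemma card_common_alternating_cycles_le:
  assumes "bij_betw f V W" "finite W"
  shows "card {B. alternating_cycle V M B \<and> alternating_cycle V A B} \<le>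
    card {B. alternating_cycle W ((`) f ` M) B \<and> alternating_cycle W ((`) f ` A) B}"
proof (rule card_inj_on_le)
  show "finite {B. alternating_cycle W ((`) f ` M) B \<and> alternating_cycle W ((`) f ` A) B}"
    by (rule finite_subset[OF _ finite_alternating_cycles[OF assms(2), of "(`) f ` M"]]) blast
  have "inj_on f V" using assms(1) by (simp add: bij_betw_def)
  then have "inj_on (image (image f)) (Pow (Pow V))" by (intro inj_on_image_Pow)
  then show "inj_on (image (image f)) {B. alternating_cycle V M B \<and> alternating_cycle V A B}"
    by (rule inj_on_subset) (auto simp: alternating_cycle_def dest: perfect_matching_edge_subset)
qed (use alternating_cycle_image[OF _ assms(1)] in blast)

lemma card_common_alternating_cycles_image:
  assumes f: "bij_betw f V W" and "finite V" "\<Union>M \<subseteq> V" "\<Union>A \<subseteq> V"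
  shows "card {B. alternating_cycle W ((`) f ` M) B \<and> alternating_cycle W ((`) f ` A) B} =
    card {B. alternating_cycle V M B \<and> alternating_cycle V A B}"
proof (rule antisym)
  have "finite W" using f assms(2) bij_betw_finite by blast
  then show "card {B. alternating_cycle V M B \<and> alternating_cycle V A B} \<le>
    card {B. alternating_cycle W ((`) f ` M) B \<and> alternating_cycle W ((`) f ` A) B}"
    by (rule card_common_alternating_cycles_le[OF f])
  \<comment> \<open>Going forth and back restores a set of edges as long as its edges lie in
    \<open>V\<close>.\<close>
  have inv: "(`) (inv_into V f) ` (`) f ` E = E" if "\<Union>E \<subseteq> V" for E
  proof -
    have "inv_into V f ` f ` e = e" if "e \<in> E" for e
      using f that \<open>\<Union>E \<subseteq> V\<close> by (intro inv_into_image_cancel) (auto simp: bij_betw_def)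
    then show ?thesis by (simp add: image_image)
  qed
  show "card {B. alternating_cycle W ((`) f ` M) B \<and> alternating_cycle W ((`) f ` A) B} \<le>
    card {B. alternating_cycle V M B \<and> alternating_cycle V A B}"
    using card_common_alternating_cycles_le[OF bij_betw_inv_into[OF f] assms(2),
        of "(`) f ` M" "(`) f ` A"]
    by (simp add: inv[OF assms(3)] inv[OF assms(4)])
qed

section \<open>Cycles as multigraphs\<close>

lemma edges_at_perfect_matching:
  assumes "perfect_matching V M" "finite V" "v \<in> V"
  shows "filter_mset (\<lambda>e. v \<in> e) (mset_set M) = {#{v, partner M v}#}"
proof -
  have "{e \<in> M. v \<in> e} = {{v, partner M v}}"
    using partner_edge[OF assms(1,3)] edge_eq_partner[OF assms(1)] by blast
  then show ?thesis
    using finite_perfect_matching[OF assms(1,2)] by (simp)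
qed

lemma degree_perfect_matching:
  assumes "perfect_matching V M" "finite V" "v \<in> V"
  shows "degree (mset_set M) v = 1"
  using edges_at_perfect_matching[OF assms] by (simp add: degree_def)

lemma degree_plus: "degree (E + F) v = degree E v + degree F v"
  by (simp add: degree_def)

lemma multigraph_plus: "multigraph V (E + F) \<longleftrightarrow> multigraph V E \<and> multigraph V F"
  by (auto simp: multigraph_def)

lemma multigraph_perfect_matching:
  assumes "perfect_matching V M" "finite V"
  shows "multigraph V (mset_set M)"
  using assms perfect_matching_edge_subset[OF assms(1)] finite_perfect_matching[OF assms]
  by (auto simp: multigraph_def perfect_matching_def)

text \<open>Regularity is automatic, and the neighbours of a vertex are precisely its two partners,
  so sets closed under both partner maps are those closed under adjacency.\<close>

lemma cycle_on_matchings_iff: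
  assumes pm: "perfect_matching V M" "perfect_matching V A" and fin: "finite V"
  shows "cycle_on V (mset_set M + mset_set A) \<longleftrightarrow> alternating_cycle V M A"
proof -
  let ?R = "{(x, y). {x, y} \<in># mset_set M + mset_set A}"
  have R: "(x, y) \<in> ?R \<longleftrightarrow> {x, y} \<in> M \<or> {x, y} \<in> A" for x y
    using finite_perfect_matching[OF pm(1) fin] finite_perfect_matching[OF pm(2) fin] by simp
  have reg: "two_regular V (mset_set M + mset_set A)"
    using degree_perfect_matching[OF pm(1) fin] degree_perfect_matching[OF pm(2) fin]
      multigraph_perfect_matching[OF pm(1) fin] multigraph_perfect_matching[OF pm(2) fin]
    by (simp add: two_regular_def degree_plus multigraph_plus)
  show ?thesis
  proof
    assume "cycle_on V (mset_set M + mset_set A)"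
    then have ne: "V \<noteq> {}" and conn: "\<And>u v. u \<in> V \<Longrightarrow> v \<in> V \<Longrightarrow> (u, v) \<in> ?R\<^sup>*"
      by (auto simp: cycle_on_def connected_graph_def)
    show "alternating_cycle V M A" unfolding alternating_cycle_def
    proof (intro conjI allI impI pm ne)
      fix S assume S: "S \<subseteq> V" "S \<noteq> {}" "partner M ` S \<subseteq> S" "partner A ` S \<subseteq> S"
      then obtain s where s: "s \<in> S" by auto
      have "v \<in> S" if "(s, v) \<in> ?R\<^sup>*" for v
        using that
      proof induction
        case (step x y)
        then have "y = partner M x \<or> y = partner A x"
          using R partner_eqI[OF pm(1), of x y] partner_eqI[OF pm(2), of x y] by blast
        then show ?case using step.IH S(3,4) by blast
      qed (rule s)
      then show "S = V" using conn S(1) s by blast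
    qed
  next
    assume alt: "alternating_cycle V M A"
    \<comment> \<open>The set of vertices reachable from \<open>u\<close> is closed under both
      partner maps.\<close>
    have "{v \<in> V. (u, v) \<in> ?R\<^sup>*} = V" if "u \<in> V" for u
    proof (rule alternating_cycle_closed_eq[OF alt])
      show "{v \<in> V. (u, v) \<in> ?R\<^sup>*} \<noteq> {}" using that by auto
      fix v assume v: "v \<in> {v \<in> V. (u, v) \<in> ?R\<^sup>*}"
      then have "(v, partner M v) \<in> ?R" "(v, partner A v) \<in> ?R"
        using R partner_edge[OF pm(1)] partner_edge[OF pm(2)] by auto
      with v show "partner M v \<in> {v \<in> V. (u, v) \<in> ?R\<^sup>*}" "partner A v \<in> {v \<in> V. (u, v) \<in> ?R\<^sup>*}"
        using partner_in[OF pm(1)] partner_in[OF pm(2)] by (auto intro: rtrancl_into_rtrancl)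
    qed auto
    moreover have "V \<noteq> {}" using alt by (simp add: alternating_cycle_def)
    ultimately have "connected_graph V (mset_set M + mset_set A)"
      unfolding connected_graph_def by blast
    then show "cycle_on V (mset_set M + mset_set A)" using reg by (simp add: cycle_on_def)
  qed
qed

text \<open>Two copies of \<open>e\<close> exhaust the degrees of both ends, so nothing outside
  \<open>e\<close> can be reached from it and \<open>V\<close> would have only two vertices.\<close>

lemma cycle_on_count_le_1:
  assumes "cycle_on V C" "card V \<ge> 3"
  shows "count C e \<le> 1"
proof (rule ccontr)
  assume "\<not> count C e \<le> 1"
  then have cnt: "count C e \<ge> 2" by simp
  then have "e \<in># C" by (metis count_greater_zero_iff less_le_trans zero_less_numeral)
  have reg: "multigraph V C" "\<And>v. v \<in> V \<Longrightarrow> degree C v = 2"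
    and conn: "\<And>u v. u \<in> V \<Longrightarrow> v \<in> V \<Longrightarrow> (u, v) \<in> {(x, y). {x, y} \<in># C}\<^sup>*"
    using assms(1) by (auto simp: cycle_on_def two_regular_def connected_graph_def)
  have e: "e \<subseteq> V" "card e = 2" using reg(1) \<open>e \<in># C\<close> by (auto simp: multigraph_def)
  then obtain u where u: "u \<in> e" by fastforce
  have only: "d = e" if "d \<in># C" "w \<in> d" "w \<in> e" for d w
  proof (rule ccontr)
    assume ne: "d \<noteq> e"
    have "count C d \<ge> 1" using that by simp
    \<comment> \<open>Another edge \<open>d\<close> at an end \<open>w\<close> of \<open>e\<close>
      would raise the degree of \<open>w\<close> to three.\<close>
    then have "add_mset d {#e, e#} \<subseteq># filter_mset (\<lambda>e. w \<in> e) C"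
      using ne cnt that by (intro mset_subset_eqI) auto
    then have "degree C w \<ge> 3" using size_mset_mono unfolding degree_def by fastforce
    then show False using reg(2)[of w] e(1) that by auto
  qed
  have "v \<in> e" if "(u, v) \<in> {(x, y). {x, y} \<in># C}\<^sup>*" for v
    using that
  proof induction
    case (step x y)
    then have "{x, y} = e" using only[of "{x, y}" x] by simp
    then show ?case by auto
  qed (rule u)
  then have "V \<subseteq> e" using conn u e(1) by blast
  then have "card V \<le> card e" using e(2) by (intro card_mono) (auto intro: card_ge_0_finite)
  then show False using e(2) assms(2) by simp
qed

text \<open>Degrees count multiplicities, so degree one excludes both repeated edges and distinct
  edges with a common end.\<close>

lemma degree_1_perfect_matching:
  assumes "multigraph V A" "\<And>v. v \<in> V \<Longrightarrow> degree A v = 1"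
  shows "perfect_matching V (set_mset A)" "A = mset_set (set_mset A)"
proof -
  have card2: "card e = 2" and sub: "e \<subseteq> V" if "e \<in># A" for e
    using assms(1) that by (auto simp: multigraph_def)
  have single: "\<exists>d. filter_mset (\<lambda>e. v \<in> e) A = {#d#}" if "v \<in> V" for v
    using assms(2)[OF that] unfolding degree_def by (rule size_1_singleton_mset)
  have unique: "e = e'" if e: "e \<in># A" "e' \<in># A" "v \<in> e" "v \<in> e'" for e e' v
  proof -
    obtain d where d: "filter_mset (\<lambda>e. v \<in> e) A = {#d#}" using single e sub by blast
    have "e \<in># filter_mset (\<lambda>e. v \<in> e) A" "e' \<in># filter_mset (\<lambda>e. v \<in> e) A" using e by auto
    then show ?thesis unfolding d by simp
  qed
  show "perfect_matching V (set_mset A)"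
  proof (rule perfect_matchingI)
    show "\<Union> (set_mset A) = V"
    proof (intro equalityI subsetI)
      fix v assume "v \<in> V"
      then obtain d where "filter_mset (\<lambda>e. v \<in> e) A = {#d#}" using single by blast
      then have "d \<in># filter_mset (\<lambda>e. v \<in> e) A" by simp
      then show "v \<in> \<Union> (set_mset A)" by auto
    qed (use sub in auto)
  qed (use card2 unique in blast)+
  show "A = mset_set (set_mset A)"
  proof (rule multiset_eqI)
    fix e
    have "count A e = 1" if e: "e \<in># A"
    proof -
      obtain v where v: "v \<in> e" using card2[OF e] by fastforce
      then obtain d where d: "filter_mset (\<lambda>e. v \<in> e) A = {#d#}" using single sub[OF e] by blast
      have "count A e = count (filter_mset (\<lambda>e. v \<in> e) A) e" using v by simp
      also have "\<dots> \<le> 1" unfolding d by simp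
      finally show ?thesis using e by (simp add: le_antisym Suc_le_eq)
    qed
    then show "count A e = count (mset_set (set_mset A)) e"
      by (cases "e \<in># A") (auto simp: not_in_iff)
  qed
qed

text \<open>No edge of \<open>M\<close> can be repeated in \<open>C1\<close> or in \<open>C2\<close>, so each of them contains \<open>M\<close> exactly
  once, and what remains is a perfect matching.\<close>

lemma compatible_cycle_double_edges_iff:
  assumes pm: "perfect_matching V M" and fin: "finite V" and "card V \<ge> 3"
  shows "compatible_cycle V (mset_set M + mset_set M) C \<longleftrightarrow>
    (\<exists>A B. alternating_cycle V M A \<and> alternating_cycle V M B \<and> alternating_cycle V A B \<and>
      C = mset_set A + mset_set B)"
proof
  assume "compatible_cycle V (mset_set M + mset_set M) C"
  then obtain C1 C2 where C: "cycle_on V C" "cycle_on V C1" "cycle_on V C2"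
    and eq: "mset_set M + mset_set M + C = C1 + C2"
    by (auto simp: compatible_cycle_def)
  have finM: "finite M" using finite_perfect_matching[OF pm fin] .
  have cnt: "1 \<le> count C1 e \<and> 1 \<le> count C2 e" if "e \<in> M" for e
  proof -
    have "2 + count C e = count C1 e + count C2 e"
      using arg_cong[OF eq, of "\<lambda>X. count X e"] that finM by simp
    then show ?thesis
      using cycle_on_count_le_1[OF C(2) assms(3), of e] cycle_on_count_le_1[OF C(3) assms(3), of e]
      by linarith
  qed
  have split: "\<exists>A. alternating_cycle V M A \<and> D = mset_set M + mset_set A"
    if D: "cycle_on V D" and "\<And>e. e \<in> M \<Longrightarrow> 1 \<le> count D e" for D
  proof -
    have "mset_set M \<subseteq># D"
      using that(2) finM by (intro mset_subset_eqI) (auto simp: count_mset_set')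
    then obtain A where A: "D = mset_set M + A" by (auto simp: mset_subset_eq_exists_conv)
    have "multigraph V A" "\<And>v. v \<in> V \<Longrightarrow> degree A v = 1"
      using D degree_perfect_matching[OF pm fin] unfolding A
      by (auto simp: cycle_on_def two_regular_def multigraph_plus degree_plus)
    note * = degree_1_perfect_matching[OF this]
    then have D_eq: "D = mset_set M + mset_set (set_mset A)" using A by simp
    with D have "alternating_cycle V M (set_mset A)"
      using cycle_on_matchings_iff[OF pm *(1) fin] by simp
    then show ?thesis using D_eq by blast
  qed
  obtain A where A: "alternating_cycle V M A" "C1 = mset_set M + mset_set A"
    using split[OF C(2)] cnt by blast
  obtain B where B: "alternating_cycle V M B" "C2 = mset_set M + mset_set B"
    using split[OF C(3)] cnt by blast
  have "C = mset_set A + mset_set B"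
    using eq unfolding A(2) B(2) by (simp add: ac_simps)
  moreover from this have "alternating_cycle V A B"
    using C(1) cycle_on_matchings_iff[OF _ _ fin] A(1) B(1) by (auto simp: alternating_cycle_def)
  ultimately show "\<exists>A B. alternating_cycle V M A \<and> alternating_cycle V M B \<and>
      alternating_cycle V A B \<and> C = mset_set A + mset_set B"
    using A B by blast
next
  assume "\<exists>A B. alternating_cycle V M A \<and> alternating_cycle V M B \<and> alternating_cycle V A B \<and>
      C = mset_set A + mset_set B"
  then obtain A B where AB: "alternating_cycle V M A" "alternating_cycle V M B"
    "alternating_cycle V A B" "C = mset_set A + mset_set B"
    by blast
  have cyc: "cycle_on V (mset_set X + mset_set Y)" if "alternating_cycle V X Y" for X Y
    using that cycle_on_matchings_iff[OF _ _ fin] by (auto simp: alternating_cycle_def)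
  have "mset_set M + mset_set M + C = (mset_set M + mset_set A) + (mset_set M + mset_set B)"
    using AB(4) by (simp add: ac_simps)
  then show "compatible_cycle V (mset_set M + mset_set M) C"
    unfolding compatible_cycle_def using cyc AB by blast
qed

section \<open>Recovering two matchings from their union, and counting pairs\<close>

lemma alternating_cycle_irrefl:
  assumes "card V \<ge> 3"
  shows "\<not> alternating_cycle V A A"
proof
  assume alt: "alternating_cycle V A A"
  then have pm: "perfect_matching V A" and "V \<noteq> {}" by (auto simp: alternating_cycle_def)
  then obtain v where v: "v \<in> V" by auto
  \<comment> \<open>A single edge of \<open>A\<close> is already closed.\<close>
  have "{v, partner A v} = V"
    using v partner_in[OF pm v] partner_partner[OF pm v]
    by (intro alternating_cycle_closed_eq[OF alt]) auto
  then have "card V = 2" using partner_neq[OF pm v] by (metis card_2_iff)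
  then show False using assms by simp
qed

text \<open>At each vertex \<open>A'\<close> and \<open>B'\<close> either agree with
  \<open>A\<close> and \<open>B\<close> or are interchanged. Agreement spreads along the edges of
  both matchings, so by connectedness it holds everywhere or nowhere.\<close>

lemma alternating_cycle_decomposition_unique:
  assumes alt: "alternating_cycle V A B" and fin: "finite V"
    and pm': "perfect_matching V A'" "perfect_matching V B'"
    and eq: "mset_set A' + mset_set B' = mset_set A + mset_set B"
  shows "A' = A \<and> B' = B \<or> A' = B \<and> B' = A"
proof -
  have pm: "perfect_matching V A" "perfect_matching V B"
    using alt by (auto simp: alternating_cycle_def)
  have dich: "partner A' v = partner A v \<and> partner B' v = partner B v \<or>
      partner A' v = partner B v \<and> partner B' v = partner A v" if "v \<in> V" for v
    using arg_cong[OF eq, of "filter_mset (\<lambda>e. v \<in> e)"] that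
    by (auto simp: edges_at_perfect_matching[OF _ fin] pm pm' add_eq_conv_ex doubleton_eq_iff)
  define S where "S = {v \<in> V. partner A' v = partner A v \<and> partner B' v = partner B v}"
  show ?thesis
  proof (cases "S = {}")
    case True
    then have "partner A' v = partner B v" "partner B' v = partner A v" if "v \<in> V" for v
      using dich[OF that] that by (auto simp: S_def)
    then show ?thesis using perfect_matching_eqI pm pm' by blast
  next
    case False
    have "S = V"
    proof (rule alternating_cycle_closed_eq[OF alt _ False])
      fix v assume v: "v \<in> S"
      then have vV: "v \<in> V" and pA: "partner A' v = partner A v" and pB: "partner B' v = partner B v"
        by (auto simp: S_def)
      have "partner A' (partner A v) = v" "partner B' (partner B v) = v"
        using partner_partner[OF pm'(1) vV] partner_partner[OF pm'(2) vV] pA pB by auto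
      \<comment> \<open>If the interchanged alternative also held at the partner, \<open>A\<close>
        and \<open>B\<close> would share the edge back to \<open>v\<close>, and then it coincides
        with agreement.\<close>
      then show "partner A v \<in> S" "partner B v \<in> S"
        using dich[OF partner_in[OF pm(1) vV]] dich[OF partner_in[OF pm(2) vV]]
          partner_in[OF pm(1) vV] partner_in[OF pm(2) vV]
          partner_partner[OF pm(1) vV] partner_partner[OF pm(2) vV]
        by (auto simp: S_def)
    qed (auto simp: S_def)
    then have "partner A' v = partner A v" "partner B' v = partner B v" if "v \<in> V" for v
      using that by (auto simp: S_def)
    then show ?thesis using perfect_matching_eqI pm pm' by blast
  qed
qed

text \<open>Double counting: \<open>(A, B)\<close> and \<open>(B, A)\<close> give the same cycle, so
  the map from ordered pairs to compatible cycles is two-to-one.\<close>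

lemma card_compatible_cycles_double_edges:
  assumes pm: "perfect_matching V M" and fin: "finite V" and "card V \<ge> 3"
  shows "2 * card {C. compatible_cycle V (mset_set M + mset_set M) C} =
    (\<Sum>A | alternating_cycle V M A. card {B. alternating_cycle V M B \<and> alternating_cycle V A B})"
proof -
  define P where "P = (SIGMA A : {A. alternating_cycle V M A}.
      {B. alternating_cycle V M B \<and> alternating_cycle V A B})"
  define \<phi> :: "'a set set \<times> 'a set set \<Rightarrow> 'a set multiset"
    where "\<phi> = (\<lambda>(A, B). mset_set A + mset_set B)"
  have finB: "finite {B. alternating_cycle V M B \<and> alternating_cycle V A B}" for A
    by (rule finite_subset[OF _ finite_alternating_cycles[OF fin, of M]]) auto
  have finP: "finite P"
    unfolding P_def using finite_alternating_cycles[OF fin] finB by (intro finite_SigmaI) auto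
  have img: "{C. compatible_cycle V (mset_set M + mset_set M) C} = \<phi> ` P"
    by (auto simp: compatible_cycle_double_edges_iff[OF assms] P_def \<phi>_def)
  have fibre: "card {p \<in> P. \<phi> p = C} = 2" if C: "C \<in> \<phi> ` P" for C
  proof -
    obtain A B where AB: "(A, B) \<in> P" "C = mset_set A + mset_set B"
      using C by (auto simp: \<phi>_def)
    then have alt: "alternating_cycle V M A" "alternating_cycle V M B" "alternating_cycle V A B"
      by (auto simp: P_def)
    have "{p \<in> P. \<phi> p = C} = {(A, B), (B, A)}"
    proof (intro equalityI subsetI)
      fix p assume p: "p \<in> {p \<in> P. \<phi> p = C}"
      obtain A' B' where p': "p = (A', B')" by (cases p)
      have "perfect_matching V A'" "perfect_matching V B'"
        "mset_set A' + mset_set B' = mset_set A + mset_set B"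
        using p AB(2) by (auto simp: p' P_def \<phi>_def alternating_cycle_def)
      from alternating_cycle_decomposition_unique[OF alt(3) fin this]
      show "p \<in> {(A, B), (B, A)}" by (auto simp: p')
    next
      fix p assume "p \<in> {(A, B), (B, A)}"
      then show "p \<in> {p \<in> P. \<phi> p = C}"
        using alt alt(3)[unfolded alternating_cycle_commute[of V A B]] AB(2)
        by (auto simp: P_def \<phi>_def add.commute)
    qed
    \<comment> \<open>Without this the fibre could collapse to one element.\<close>
    moreover have "A \<noteq> B" using alt(3) alternating_cycle_irrefl[OF assms(3)] by blast
    ultimately show ?thesis by simp
  qed
  have "card P = (\<Sum>C\<in>\<phi> ` P. card {p \<in> P. \<phi> p = C})"
    using sum.image_gen[OF finP, of "\<lambda>_. 1::nat" \<phi>] by simp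
  also have "\<dots> = 2 * card (\<phi> ` P)" using fibre by simp
  finally have "2 * card (\<phi> ` P) = card P" ..
  also have "\<dots> = (\<Sum>A | alternating_cycle V M A.
      card {B. alternating_cycle V M B \<and> alternating_cycle V A B})"
    unfolding P_def using finite_alternating_cycles[OF fin] finB by (intro card_SigmaI) auto
  finally show ?thesis using img by simp
qed

lemma disjoint_cycles_1_iff: "disjoint_cycles V E 1 \<longleftrightarrow> cycle_on V E"
proof
  assume "disjoint_cycles V E 1"
  then obtain P F where *: "card P = 1" "partition_on V P" "\<forall>W\<in>P. cycle_on W (F W)" "E = (\<Sum>W\<in>P. F W)"
    by (auto simp: disjoint_cycles_def)
  from *(1) obtain W where "P = {W}" by (rule card_1_singletonE)
  with * show "cycle_on V E" by (auto simp: partition_on_def)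
next
  assume E: "cycle_on V E"
  then have "V \<noteq> {}" by (simp add: cycle_on_def connected_graph_def)
  then have "partition_on V {V}" by (simp add: partition_on_def)
  with E show "disjoint_cycles V E 1"
    unfolding disjoint_cycles_def by (intro exI[of _ "{V}"] exI[of _ "\<lambda>_. E"]) simp
qed

section \<open>Signed permutations\<close>

text \<open>The entry that comes first in the pair replacing \<open>x\<close> in
  \<open>extended_perm\<close>; \<open>upper_end\<close> is the second. The names refer to position:
  for negative \<open>x\<close> the lower end is the larger number.\<close>

definition lower_end :: "int \<Rightarrow> int" where
  "lower_end x = (if x > 0 then 2 * x - 1 else 2 * \<bar>x\<bar>)"

definition upper_end :: "int \<Rightarrow> int" where
  "upper_end x = (if x > 0 then 2 * x else 2 * \<bar>x\<bar> - 1)"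

lemma ends_eqD:
  assumes "lower_end x = lower_end y" "upper_end x = upper_end y" "x \<noteq> 0" "y \<noteq> 0"
  shows "x = y"
  using assms unfolding lower_end_def upper_end_def by (simp split: if_splits)

lemma ends_doubleton: "{lower_end x, upper_end x} = {2 * \<bar>x\<bar> - 1, 2 * \<bar>x\<bar>}"
  by (auto simp: lower_end_def upper_end_def)

section \<open>Entries of the extended permutation\<close>

lemma concat_pairs_nth:
  assumes "i < length xs"
  shows "concat (map (\<lambda>x. [f x, g x]) xs) ! (2 * i) = f (xs ! i) \<and>
    concat (map (\<lambda>x. [f x, g x]) xs) ! (2 * i + 1) = g (xs ! i)"
  using assms
proof (induction xs arbitrary: i)
  case (Cons x xs)
  then show ?case by (cases i) simp_all
qed simp

lemma length_concat_pairs: "length (concat (map (\<lambda>x. [f x, g x]) xs)) = 2 * length xs"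
  by (induction xs) auto

lemma extended_perm_altdef:
  "extended_perm \<pi> =
    0 # concat (map (\<lambda>x. [lower_end x, upper_end x]) \<pi>) @ [2 * int (length \<pi>) + 1]"
proof -
  have "(\<lambda>x :: int. if x > 0 then [2 * x - 1, 2 * x] else [2 * \<bar>x\<bar>, 2 * \<bar>x\<bar> - 1]) =
    (\<lambda>x. [lower_end x, upper_end x])"
    by (auto simp: fun_eq_iff lower_end_def upper_end_def)
  then show ?thesis by (simp add: extended_perm_def)
qed

lemma length_extended_perm: "length (extended_perm \<pi>) = 2 * length \<pi> + 2"
  by (simp add: extended_perm_altdef length_concat_pairs)

lemma extended_perm_0: "extended_perm \<pi> ! 0 = 0"
  by (simp add: extended_perm_altdef)

lemma extended_perm_last: "extended_perm \<pi> ! (2 * length \<pi> + 1) = 2 * int (length \<pi>) + 1"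
  by (simp add: extended_perm_altdef nth_append length_concat_pairs)

lemma extended_perm_inner:
  assumes "i < length \<pi>"
  shows "extended_perm \<pi> ! (2 * i + 1) = lower_end (\<pi> ! i)"
    and "extended_perm \<pi> ! (2 * i + 2) = upper_end (\<pi> ! i)"
  using concat_pairs_nth[OF assms, of lower_end upper_end] assms
  by (simp_all add: extended_perm_altdef nth_append length_concat_pairs)

lemma set_extended_perm:
  assumes "\<pi> \<in> signed_perms m"
  shows "set (extended_perm \<pi>) = {0..2 * int m + 1}"
proof -
  have m: "length \<pi> = m" and abs: "abs ` set \<pi> = {1..int m}"
    using assms by (auto simp: signed_perms_def)
  have "set (concat (map (\<lambda>x. [lower_end x, upper_end x]) \<pi>)) =
      (\<Union>x\<in>set \<pi>. {lower_end x, upper_end x})"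
    by auto
  also have "\<dots> = (\<Union>k\<in>abs ` set \<pi>. {2 * k - 1, 2 * k})"
    by (simp only: ends_doubleton image_image)
  also have "\<dots> = {1..2 * int m}" unfolding abs
  proof (intro equalityI subsetI)
    fix y assume "y \<in> {1..2 * int m}"
    then have "(y + 1) div 2 \<in> {1..int m}" "y \<in> {2 * ((y + 1) div 2) - 1, 2 * ((y + 1) div 2)}"
      by auto
    then show "y \<in> (\<Union>k\<in>{1..int m}. {2 * k - 1, 2 * k})" by blast
  qed auto
  finally show ?thesis by (auto simp: extended_perm_altdef m)
qed

lemma bij_betw_extended_perm:
  assumes "\<pi> \<in> signed_perms m"
  shows "bij_betw ((!) (extended_perm \<pi>)) {..<2 * m + 2} {0..2 * int m + 1}"
proof (rule bij_betw_nth)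
  have "length \<pi> = m" using assms by (simp add: signed_perms_def)
  \<comment> \<open>Distinctness follows by counting: the list has length \<open>2 * m + 2\<close>
    and as many different entries.\<close>
  then show "{..<2 * m + 2} = {..<length (extended_perm \<pi>)}"
    and "distinct (extended_perm \<pi>)"
    by (simp_all add: length_extended_perm card_distinct set_extended_perm[OF assms])
qed (simp add: set_extended_perm[OF assms])

lemma bij_betw_int_lessThan: "bij_betw int {..<2 * m + 2} {0..2 * int m + 1}"
  by (rule bij_betwI[of _ _ _ nat]) auto

text \<open>An entry \<open>x\<close> contributes the edge joining
  \<open>2 * \<bar>x\<bar> - 1\<close> and \<open>2 * \<bar>x\<bar>\<close> whatever its position
  and sign, and the closing edge joins the fixed ends. So this matching is the same for all signed
  permutations.\<close>

lemma odd_matching_extended_perm: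
  assumes "\<pi> \<in> signed_perms m"
  shows "odd_matching ((!) (extended_perm \<pi>)) m = odd_matching int m"
proof (rule perfect_matching_eq_of_subset)
  have m: "length \<pi> = m" and abs: "abs ` set \<pi> = {1..int m}"
    using assms by (auto simp: signed_perms_def)
  have "{extended_perm \<pi> ! (2 * i + 1), extended_perm \<pi> ! (2 * i + 2)} \<in> odd_matching int m"
    if "i < m" for i
  proof -
    have "\<bar>\<pi> ! i\<bar> \<in> {1..int m}" using abs nth_mem[of i \<pi>] that m by blast
    \<comment> \<open>Absolute values start at 1 whereas the edges of \<open>odd_matching\<close>
      are indexed from 0.\<close>
    then have k: "nat \<bar>\<pi> ! i\<bar> - 1 < m" "int (nat \<bar>\<pi> ! i\<bar> - 1) = \<bar>\<pi> ! i\<bar> - 1" by auto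
    have "{extended_perm \<pi> ! (2 * i + 1), extended_perm \<pi> ! (2 * i + 2)} =
        {2 * \<bar>\<pi> ! i\<bar> - 1, 2 * \<bar>\<pi> ! i\<bar>}"
      using extended_perm_inner[of i \<pi>] that m ends_doubleton by simp
    also have "\<dots> = {int (2 * (nat \<bar>\<pi> ! i\<bar> - 1) + 1), int (2 * (nat \<bar>\<pi> ! i\<bar> - 1) + 2)}"
      using k(2) by simp
    finally show ?thesis using k(1) unfolding odd_matching_def by blast
  qed
  moreover have "extended_perm \<pi> ! (2 * m + 1) = int (2 * m + 1)"
    using extended_perm_last[of \<pi>] m by simp
  ultimately show "odd_matching ((!) (extended_perm \<pi>)) m \<subseteq> odd_matching int m"
    using extended_perm_0[of \<pi>] by (auto simp: odd_matching_def)
qed (use perfect_matching_odd bij_betw_extended_perm[OF assms] bij_betw_int_lessThan in blast)+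

text \<open>Different indices give different edges, so passing from the set to the indexed multiset
  of the breakpoint graph loses no multiplicity.\<close>

lemma mset_set_even_matching:
  assumes "bij_betw a {..<2 * m + 2} V"
  shows "mset_set (even_matching a m) = {# {a (2 * i), a (2 * i + 1)}. i \<in># mset_set {0..m} #}"
proof -
  have "inj_on (\<lambda>i. {a (2 * i), a (2 * i + 1)}) {..m}"
  proof (rule inj_onI)
    fix i j assume ij: "i \<in> {..m}" "j \<in> {..m}"
      and eq: "{a (2 * i), a (2 * i + 1)} = {a (2 * j), a (2 * j + 1)}"
    from eq have "a (2 * i) = a (2 * j) \<or> a (2 * i) = a (2 * j + 1)" by blast
    moreover have "inj_on a {..<2 * m + 2}" using assms by (simp add: bij_betw_def)
    ultimately have "2 * i = 2 * j \<or> 2 * i = 2 * j + 1"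
      using ij by (auto dest: inj_onD)
    then show "i = j" by presburger
  qed
  then show ?thesis
    by (simp add: even_matching_def image_mset_mset_set atMost_atLeast0)
qed

text \<open>Grey edges are the even matching of the identity order, black edges that of the extended
  permutation.\<close>

lemma disjoint_cycles_breakpoint_graph_iff:
  assumes "\<pi> \<in> signed_perms m"
  shows "disjoint_cycles {0..2 * int m + 1} (breakpoint_graph \<pi>) 1 \<longleftrightarrow>
    alternating_cycle {0..2 * int m + 1} (even_matching int m)
      (even_matching ((!) (extended_perm \<pi>)) m)"
proof -
  have m: "length \<pi> = m" using assms by (simp add: signed_perms_def)
  have "breakpoint_graph \<pi> =
      mset_set (even_matching int m) + mset_set (even_matching ((!) (extended_perm \<pi>)) m)"
    unfolding breakpoint_graph_def black_edges_def grey_edges_def m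
      mset_set_even_matching[OF bij_betw_int_lessThan]
      mset_set_even_matching[OF bij_betw_extended_perm[OF assms]]
    by (simp add: add.commute)
  then show ?thesis
    using cycle_on_matchings_iff perfect_matching_even bij_betw_int_lessThan
      bij_betw_extended_perm[OF assms] disjoint_cycles_1_iff
    by (metis finite_atLeastAtMost_int)
qed

text \<open>Each pair \<open>a (2 * i + 1)\<close>, \<open>a (2 * i + 2)\<close> is an edge of the
  standard odd matching: the edge gives an absolute value, and the order of its ends gives the
  sign.\<close>

lemma signed_perm_of_enumeration:
  assumes bij: "bij_betw a {..<2 * m + 2} {0..2 * int m + 1}" and "a 0 = 0"
    and odd: "odd_matching a m = odd_matching int m"
  obtains \<pi> where "\<pi> \<in> signed_perms m" "\<And>i. i < 2 * m + 2 \<Longrightarrow> extended_perm \<pi> ! i = a i"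
proof -
  have inj: "inj_on a {..<2 * m + 2}" using bij by (simp add: bij_betw_def)
  have "\<exists>x. x \<noteq> 0 \<and> \<bar>x\<bar> \<in> {1..int m} \<and> lower_end x = a (2 * i + 1) \<and> upper_end x = a (2 * i + 2)"
    if i: "i < m" for i
  proof -
    have "{a (2 * i + 1), a (2 * i + 2)} \<in> odd_matching a m"
      using i unfolding odd_matching_def by blast
    then have "{a (2 * i + 1), a (2 * i + 2)} \<in> odd_matching int m" by (simp only: odd)
    \<comment> \<open>The closing edge contains 0, which is taken by position 0.\<close>
    moreover have "a (2 * i + 1) \<noteq> 0" "a (2 * i + 2) \<noteq> 0"
      using inj_onD[OF inj, of "2 * i + 1" 0] inj_onD[OF inj, of "2 * i + 2" 0] i assms(2) by auto
    then have "{a (2 * i + 1), a (2 * i + 2)} \<noteq> {int (2 * m + 1), int 0}"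
      by (auto simp: doubleton_eq_iff)
    ultimately obtain k where k: "k < m"
      and "{a (2 * i + 1), a (2 * i + 2)} = {int (2 * k + 1), int (2 * k + 2)}"
      unfolding odd_matching_def by blast
    then consider "a (2 * i + 1) = 2 * int k + 1" "a (2 * i + 2) = 2 * int k + 2"
      | "a (2 * i + 1) = 2 * int k + 2" "a (2 * i + 2) = 2 * int k + 1"
      by (auto simp: doubleton_eq_iff)
    then show ?thesis
    proof cases
      case 1
      then show ?thesis
        using k by (intro exI[of _ "int k + 1"]) (auto simp: lower_end_def upper_end_def)
    next
      case 2
      then show ?thesis
        using k by (intro exI[of _ "- (int k + 1)"]) (auto simp: lower_end_def upper_end_def)
    qed
  qed
  then obtain p where p: "\<And>i. i < m \<Longrightarrow> p i \<noteq> 0" "\<And>i. i < m \<Longrightarrow> \<bar>p i\<bar> \<in> {1..int m}"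
    "\<And>i. i < m \<Longrightarrow> lower_end (p i) = a (2 * i + 1)" "\<And>i. i < m \<Longrightarrow> upper_end (p i) = a (2 * i + 2)"
    by metis
  define \<pi> where "\<pi> = map p [0..<m]"
  have inj_abs: "inj_on (\<lambda>i. \<bar>p i\<bar>) {..<m}"
  proof (rule inj_onI)
    fix i j assume ij: "i \<in> {..<m}" "j \<in> {..<m}" and "\<bar>p i\<bar> = \<bar>p j\<bar>"
    then have "{a (2 * i + 1), a (2 * i + 2)} = {a (2 * j + 1), a (2 * j + 2)}"
      using ends_doubleton[of "p i"] ends_doubleton[of "p j"] p(3,4) by simp
    then have "a (2 * i + 1) = a (2 * j + 1) \<or> a (2 * i + 1) = a (2 * j + 2)" by blast
    then have "2 * i + 1 = 2 * j + 1 \<or> 2 * i + 1 = 2 * j + 2"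
      using inj_onD[OF inj, of "2 * i + 1" "2 * j + 1"] inj_onD[OF inj, of "2 * i + 1" "2 * j + 2"] ij
      by auto
    then show "i = j" by presburger
  qed
  have map_abs: "map abs \<pi> = map (\<lambda>i. \<bar>p i\<bar>) [0..<m]" by (simp add: \<pi>_def)
  have "distinct (map abs \<pi>)"
    unfolding map_abs using inj_abs by (simp add: distinct_map atLeast0LessThan)
  \<comment> \<open>The \<open>m\<close> absolute values are distinct elements of a set of size
    \<open>m\<close>.\<close>
  moreover have "(\<lambda>i. \<bar>p i\<bar>) ` {..<m} = {1..int m}"
    using p(2) card_image[OF inj_abs] by (intro card_subset_eq) auto
  then have "set (map abs \<pi>) = {1..int m}"
    unfolding map_abs by (simp add: atLeast0LessThan)
  ultimately have mem: "\<pi> \<in> signed_perms m" by (simp add: signed_perms_def \<pi>_def image_image)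
  \<comment> \<open>Both numbers are the partner of 0 in the odd matching.\<close>
  have last: "a (2 * m + 1) = 2 * int m + 1"
  proof -
    note pm = perfect_matching_odd[OF bij_betw_int_lessThan[of m]]
    have "{a (2 * m + 1), a 0} \<in> odd_matching int m"
      unfolding odd[symmetric] by (simp add: odd_matching_def)
    then have "{0, a (2 * m + 1)} \<in> odd_matching int m" by (simp add: assms(2) insert_commute)
    moreover have "{0, 2 * int m + 1} \<in> odd_matching int m"
      by (simp add: odd_matching_def insert_commute add.commute)
    ultimately show ?thesis using partner_eqI[OF pm] by metis
  qed
  have len: "length \<pi> = m" by (simp add: \<pi>_def)
  have "extended_perm \<pi> ! i = a i" if i: "i < 2 * m + 2" for i
  proof -
    consider "i = 0" | "i = 2 * m + 1" | j where "j < m" "i = 2 * j + 1" | j where "j < m" "i = 2 * j + 2"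
    proof (cases "i = 0 \<or> i = 2 * m + 1")
      case False
      then have "(i - 1) div 2 < m" "i = 2 * ((i - 1) div 2) + 1 \<or> i = 2 * ((i - 1) div 2) + 2"
        using i by auto
      then show ?thesis using that(3,4) by blast
    qed (use that(1,2) in blast)
    then show ?thesis
    proof cases
      case 1
      then show ?thesis using extended_perm_0 assms(2) by simp
    next
      case 2
      then show ?thesis using extended_perm_last[of \<pi>] last len by simp
    next
      case (3 j)
      then show ?thesis using extended_perm_inner(1)[of j \<pi>] p(3) len by (simp add: \<pi>_def)
    next
      case (4 j)
      then show ?thesis using extended_perm_inner(2)[of j \<pi>] p(4) len by (simp add: \<pi>_def)
    qed
  qed
  with mem show ?thesis by (rule that)
qed

text \<open>Walking from 0 along an alternating cycle lists an extended permutation. Conversely the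
  fixed odd matching and the black edges determine that walk, hence the signed permutation.\<close>

lemma bij_betw_signed_perms_alternating_cycles:
  "bij_betw (\<lambda>\<pi>. even_matching ((!) (extended_perm \<pi>)) m) (signed_perms m)
    {B. alternating_cycle {0..2 * int m + 1} (odd_matching int m) B}"
  unfolding bij_betw_def
proof (intro conjI equalityI subsetI)
  show "inj_on (\<lambda>\<pi>. even_matching ((!) (extended_perm \<pi>)) m) (signed_perms m)"
  proof (rule inj_onI)
    fix \<pi> \<rho> assume mem: "\<pi> \<in> signed_perms m" "\<rho> \<in> signed_perms m"
      and eq: "even_matching ((!) (extended_perm \<pi>)) m = even_matching ((!) (extended_perm \<rho>)) m"
    have same: "extended_perm \<pi> ! i = extended_perm \<rho> ! i" if "i < 2 * m + 2" for i
    proof (rule alternating_cycle_enumerations_eq[OF bij_betw_extended_perm[OF mem(1)]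
          bij_betw_extended_perm[OF mem(2)] _ _ eq that])
      show "odd_matching ((!) (extended_perm \<pi>)) m = odd_matching ((!) (extended_perm \<rho>)) m"
        using odd_matching_extended_perm mem by metis
    qed (simp add: extended_perm_0)
    have len: "length \<pi> = m" "length \<rho> = m" and "0 \<notin> abs ` set \<pi>" "0 \<notin> abs ` set \<rho>"
      using mem by (auto simp: signed_perms_def)
    then have nz: "0 \<notin> set \<pi>" "0 \<notin> set \<rho>" by (metis abs_0 imageI)+
    show "\<pi> = \<rho>"
    proof (rule nth_equalityI)
      fix i assume i: "i < length \<pi>"
      show "\<pi> ! i = \<rho> ! i"
      proof (rule ends_eqD)
        show "lower_end (\<pi> ! i) = lower_end (\<rho> ! i)" "upper_end (\<pi> ! i) = upper_end (\<rho> ! i)"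
          using same[of "2 * i + 1"] same[of "2 * i + 2"] i len
            extended_perm_inner[of i \<pi>] extended_perm_inner[of i \<rho>] by simp_all
        show "\<pi> ! i \<noteq> 0" using nz(1) i by (metis nth_mem)
        show "\<rho> ! i \<noteq> 0" using nz(2) i len by (metis nth_mem)
      qed
    qed (simp add: len)
  qed
next
  fix B assume "B \<in> (\<lambda>\<pi>. even_matching ((!) (extended_perm \<pi>)) m) ` signed_perms m"
  then obtain \<pi> where \<pi>: "\<pi> \<in> signed_perms m" "B = even_matching ((!) (extended_perm \<pi>)) m" by auto
  then show "B \<in> {B. alternating_cycle {0..2 * int m + 1} (odd_matching int m) B}"
    using alternating_cycle_enumeration[OF bij_betw_extended_perm[OF \<pi>(1)]]
    by (simp add: odd_matching_extended_perm)
next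
  fix B assume "B \<in> {B. alternating_cycle {0..2 * int m + 1} (odd_matching int m) B}"
  then have alt: "alternating_cycle {0..2 * int m + 1} (odd_matching int m) B" by simp
  have "card {0..2 * int m + 1} = 2 * m + 2" "0 \<in> {0..2 * int m + 1}" by auto
  then obtain a where a: "bij_betw a {..<2 * m + 2} {0..2 * int m + 1}" "a 0 = 0"
    "odd_matching int m = odd_matching a m" "B = even_matching a m"
    by (rule alternating_cycle_obtain_enumeration[OF alt])
  obtain \<pi> where \<pi>: "\<pi> \<in> signed_perms m"
    and eq: "\<And>i. i < 2 * m + 2 \<Longrightarrow> extended_perm \<pi> ! i = a i"
    using signed_perm_of_enumeration[OF a(1,2) a(3)[symmetric]] by blast
  have "B = even_matching ((!) (extended_perm \<pi>)) m"
    unfolding a(4) by (rule even_matching_cong) (simp add: eq)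
  with \<pi> show "B \<in> (\<lambda>\<pi>. even_matching ((!) (extended_perm \<pi>)) m) ` signed_perms m" by blast
qed

text \<open>The preceding bijection restricts to the permutations whose black and grey edges form a
  single cycle.\<close>

lemma signed_hultman_1_eq:
  "signed_hultman m 1 = card {B. alternating_cycle {0..2 * int m + 1} (odd_matching int m) B \<and>
     alternating_cycle {0..2 * int m + 1} (even_matching int m) B}"
proof -
  let ?V = "{0..2 * int m + 1}" and ?f = "\<lambda>\<pi>. even_matching ((!) (extended_perm \<pi>)) m"
  have "bij_betw ?f {\<pi> \<in> signed_perms m. alternating_cycle ?V (even_matching int m) (?f \<pi>)}
    {B \<in> {B. alternating_cycle ?V (odd_matching int m) B}.
      alternating_cycle ?V (even_matching int m) B}"
    by (rule bij_betw_Collect[OF bij_betw_signed_perms_alternating_cycles]) simp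
  moreover have "{\<pi> \<in> signed_perms m. disjoint_cycles ?V (breakpoint_graph \<pi>) 1} =
      {\<pi> \<in> signed_perms m. alternating_cycle ?V (even_matching int m) (?f \<pi>)}"
    using disjoint_cycles_breakpoint_graph_iff by blast
  ultimately show ?thesis
    unfolding signed_hultman_def by (auto dest: bij_betw_same_card)
qed

text \<open>A signed permutation splits into a permutation of absolute values and a list of
  \<open>m\<close> sign bits.\<close>

lemma card_signed_perms: "card (signed_perms m) = 2 ^ m * fact m"
proof -
  let ?f = "\<lambda>\<pi> :: int list. (map abs \<pi>, map (\<lambda>x. x > 0) \<pi>)"
  let ?g = "\<lambda>(ks, bs). map2 (\<lambda>k b. if b then k else - k) ks bs"
  let ?P = "permutations_of_set {1..int m}" and ?B = "{bs :: bool list. length bs = m}"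
  have "bij_betw ?f (signed_perms m) (?P \<times> ?B)"
  proof (rule bij_betwI[of _ _ _ ?g])
    show "?f \<in> signed_perms m \<rightarrow> ?P \<times> ?B"
      by (auto simp: signed_perms_def permutations_of_set_def)
    \<comment> \<open>Absolute values are at least 1, so the sign bit can be read off from
      positivity.\<close>
    have map2: "map abs (?g (ks, bs)) = ks" "map (\<lambda>x. x > 0) (?g (ks, bs)) = bs"
      if "length ks = length bs" "\<forall>k\<in>set ks. k \<ge> 1" for ks :: "int list" and bs
      using that by (induction ks bs rule: list_induct2) auto
    have P: "length ks = m" "\<forall>k\<in>set ks. k \<ge> 1" "distinct ks" "set ks = {1..int m}"
      if "ks \<in> ?P" for ks
      using that length_finite_permutations_of_set[OF that] by (auto simp: permutations_of_set_def)
    show "?f (?g p) = p" if "p \<in> ?P \<times> ?B" for p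
      using that map2 P by (cases p) auto
    show "?g \<in> ?P \<times> ?B \<rightarrow> signed_perms m"
    proof
      fix p assume p: "p \<in> ?P \<times> ?B"
      obtain ks bs where "p = (ks, bs)" by (cases p)
      then show "?g p \<in> signed_perms m"
        using p P[of ks] map2(1)[of ks bs] by (simp add: signed_perms_def del: set_map)
    qed
    show "?g (?f \<pi>) = \<pi>" if "\<pi> \<in> signed_perms m" for \<pi>
      by (induction \<pi>) auto
  qed
  then have "card (signed_perms m) = card (?P \<times> ?B)" by (rule bij_betw_same_card)
  then have "card (signed_perms m) = card ?P * card ?B" by (simp only: card_cartesian_product)
  moreover have "card ?B = 2 ^ m"
    using card_lists_length_eq[of "UNIV :: bool set" m] by simp
  ultimately show ?thesis by simp
qed

section \<open>The final count\<close>

lemma double_factorial_even: "double_factorial (2 * m) = 2 ^ m * fact m"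
  by (induction m) (simp_all add: algebra_simps)

text \<open>Some bijection carries \<open>M\<close> to the standard odd matching, whose completions
  are counted by signed permutations.\<close>

lemma card_alternating_cycles:
  assumes pm: "perfect_matching V M" and "card V = 2 * m + 2"
  shows "card {A. alternating_cycle V M A} = double_factorial (2 * m)"
proof -
  let ?W = "{0..2 * int m + 1}" and ?O = "odd_matching int m"
  have fin: "finite V" using assms(2) by (intro card_ge_0_finite) simp
  obtain f where f: "bij_betw f V ?W" "(`) f ` M = ?O"
    using perfect_matchings_isomorphic[OF pm perfect_matching_odd[OF bij_betw_int_lessThan[of m]] fin]
      bij_betw_same_card[OF bij_betw_int_lessThan[of m]] assms(2) by auto
  have "\<Union>M \<subseteq> V" using perfect_matching_edge_subset[OF pm] by blast
  \<comment> \<open>Taking both matchings equal to \<open>M\<close> turns the count of common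
    completions into the plain one.\<close>
  then have "card {A. alternating_cycle V M A} = card {B. alternating_cycle ?W ?O B}"
    using card_common_alternating_cycles_image[OF f(1) fin, of M M] f(2) by simp
  also have "\<dots> = card (signed_perms m)"
    using bij_betw_same_card[OF bij_betw_signed_perms_alternating_cycles] by metis
  finally show ?thesis by (simp add: card_signed_perms double_factorial_even)
qed

text \<open>Numbering the vertices along the cycle of \<open>M\<close> and \<open>A\<close> brings
  both matchings into standard form at once, so the count does not depend on
  \<open>A\<close>.\<close>

lemma card_common_alternating_cycles:
  assumes alt: "alternating_cycle V M A" and "card V = 2 * m + 2"
  shows "card {B. alternating_cycle V M B \<and> alternating_cycle V A B} = signed_hultman m 1"
proof -
  have fin: "finite V" using assms(2) by (intro card_ge_0_finite) simp
  obtain z where "z \<in> V" using alt by (auto simp: alternating_cycle_def)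
  then obtain a where a: "bij_betw a {..<2 * m + 2} V" and "a 0 = z"
    and MA: "M = odd_matching a m" "A = even_matching a m"
    by (rule alternating_cycle_obtain_enumeration[OF assms])
  \<comment> \<open>A vertex is sent to its position on the walk.\<close>
  define f where "f = int \<circ> inv_into {..<2 * m + 2} a"
  have f: "bij_betw f V {0..2 * int m + 1}"
    unfolding f_def by (rule bij_betw_trans[OF bij_betw_inv_into[OF a] bij_betw_int_lessThan])
  have fa: "(f \<circ> a) i = int i" if "i < 2 * m + 2" for i
    using that a by (simp add: f_def bij_betw_def)
  have "(`) f ` M = odd_matching int m" "(`) f ` A = even_matching int m"
    unfolding MA odd_matching_image even_matching_image
    by (rule odd_matching_cong even_matching_cong, erule fa)+
  moreover have "\<Union>M \<subseteq> V" "\<Union>A \<subseteq> V"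
    using alt by (auto simp: alternating_cycle_def dest: perfect_matching_edge_subset)
  ultimately show ?thesis
    using card_common_alternating_cycles_image[OF f fin, of M A] signed_hultman_1_eq by simp
qed

theorem mainTheorem4:
  fixes n :: nat and V :: "'a set" and G :: "'a set multiset"
  assumes "n \<ge> 4" and "even n"
    and "finite V" and "card V = n"
    and "disjoint_double_edges V G"
  shows "real (card {C. compatible_cycle V G C}) =
           1 / 2 * real (double_factorial (n - 2)) * real (signed_hultman (n div 2 - 1) 1)"
proof -
  define m where "m = n div 2 - 1"
  \<comment> \<open>The walk has \<open>m + 1\<close> edges of each matching, which accounts for the
    shift to \<open>n div 2 - 1\<close>.\<close>
  have n: "n = 2 * m + 2" using assms(1,2) by (auto simp: m_def)
  obtain M where M: "perfect_matching V M" "G = mset_set M + mset_set M"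
    using assms(5) by (auto simp: disjoint_double_edges_def perfect_matching_def)
  have "2 * card {C. compatible_cycle V G C} =
      (\<Sum>A | alternating_cycle V M A. card {B. alternating_cycle V M B \<and> alternating_cycle V A B})"
    unfolding M(2) using assms(1,4) by (intro card_compatible_cycles_double_edges[OF M(1) assms(3)]) simp
  also have "\<dots> = (\<Sum>A | alternating_cycle V M A. signed_hultman m 1)"
    using card_common_alternating_cycles assms(4) n by (intro sum.cong) auto
  also have "\<dots> = double_factorial (2 * m) * signed_hultman m 1"
    using card_alternating_cycles[OF M(1)] assms(4) n by simp
  finally have "2 * card {C. compatible_cycle V G C} = double_factorial (n - 2) * signed_hultman m 1"
    using n by simp
  \<comment> \<open>The identity is doubled over the naturals; the halving takes place in the
    reals.\<close>
  from arg_cong[OF this, of real] show ?thesis by (simp add: m_def)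
qed

end
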